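(* For any subset $A\in\mathcal{P}([n])$, $$L(\mathfrak{S}_n)=\ker M_A\oplus\Big[V^0\oplus\bigoplus_{B\in\mathcal{P}(A)}W_B\Big],$$ and for any observation design, i.e. any collection $\mathcal{A}\subset\mathcal{P}([n])$, $$L(\mathfrak{S}_n)=\ker M_{\mathcal{A}}\oplus\Big[V^0\oplus\bigoplus_{B\in\bigcup_{A\in\mathcal{A}}\mathcal{P}(A)}W_B\Big].$$
   Context: Let $n$ be a positive integer and $[n]=\{1,\dots,n\}$. For a finite set $E$, $\mathcal{P}(E)$ denotes the set of all subsets of $E$ with at least two elements, and $L(E)$ the real vector space of functions $E\to\mathbb{R}$; an element of $E$ is identified with its Dirac function in $L(E)$, and $\mathbf{1}_S$ is the indicator function of $S\subset E$. An injective word over $[n]$ is a finite sequence $\omega=\omega_1\cdots\omega_k$ of distinct elements of $[n]$ ($0\le k\le n$, the empty word being allowed); its content is $c(\omega)=\{\omega_1,\dots,\omega_k\}$. $\Gamma_n$ is the set of all injective words over $[n]$, and $\Gamma(A)=\{\omega\in\Gamma_n : c(\omega)=A\}$ for $A\subset[n]$; $L(\Gamma(A))$ is viewed as a subspace of $L(\Gamma_n)$. The symmetric group $\mathfrak{S}_n$ is identified, as a set, with $\Gamma([n])$ (a permutation $\sigma$ corresponds to the word $\sigma^{-1}(1)\cdots\sigma^{-1}(n)$). For $A\in\mathcal{P}([n])$ and a word $\sigma\in\Gamma([n])$, $\sigma_{|A}\in\Gamma(A)$ is the word obtained from $\sigma$ by deleting all letters not in $A$. The marginal operator $M_A:L(\mathfrak{S}_n)\to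 L(\Gamma(A))$ is the linear map with $M_A\sigma=\sigma_{|A}$ on Dirac functions, i.e. $(M_Af)(\pi)=\sum_{\sigma\in\mathfrak{S}_n,\ \sigma_{|A}=\pi}f(\sigma)$. For a collection $\mathcal{A}\subset\mathcal{P}([n])$, $M_{\mathcal{A}}:L(\mathfrak{S}_n)\to\bigoplus_{A\in\mathcal{A}}L(\Gamma(A))$ is $f\mapsto(M_Af)_{A\in\mathcal{A}}$. For $a\in[n]$, the deletion operator $\varrho_a:L(\Gamma_n)\to L(\Gamma_n)$ is the linear map sending the Dirac function of a word $\pi$ to that of the word obtained from $\pi$ by deleting the letter $a$ if $a\in c(\pi)$, and to that of $\pi$ itself otherwise. For $B\in\mathcal{P}([n])$, $$H_B=\{x\in L(\Gamma(B)) : \varrho_b(x)=0\text{ for all }b\in B\}.$$ For a word $\pi\in\Gamma_n$, $\mathfrak{S}_n[\pi]$ is the set of words $\sigma\in\Gamma([n])$ that contain $\pi$ as a contiguous subword, i.e. of the form $\sigma=\omega_1\pi\omega_2$ with $\omega_1,\omega_2\in\Gamma_n$. The linear operator $\phi_n:L(\Gamma_n)\to L(\mathfrak{S}_n)$ is defined on Dirac functions by $\phi_n\pi=\mathbf{1}_{\mathfrak{S}_n[\pi]}$, and $W_B:=\phi_n(H_B)\subset L(\mathfrak{S}_n)$. $V^0$ is the space of constant functions on $\mathfrak{S}_n$.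
   Formalization: The observation design is assumed nonempty: for the empty collection the kernel is all of L(S_n), which meets the one-dimensional space V^0 nontrivially, so the stated direct sum fails there. *)

theory Defs
  imports Complex_Main "HOL-Library.Function_Algebras" "HOL-Library.Set_Algebras"
    "HOL-Library.Indicator_Function" "HOL-Library.Sublist"
    "HOL-Combinatorics.Multiset_Permutations"
begin

definition fun_scale :: "real \<Rightarrow> ('a \<Rightarrow> real) \<Rightarrow> 'a \<Rightarrow> real" where
  "fun_scale c f = (\<lambda>x. c * f x)"

interpretation fun_space: vector_space fun_scale
  by unfold_locales (auto simp: fun_scale_def fun_eq_iff algebra_simps)

text \<open>A function on \<open>E\<close> is represented by its extension by zero, so that
  \<open>E \<subseteq> F\<close> makes \<open>funs_on E\<close> a subspace of \<open>funs_on F\<close>.\<close>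

definition funs_on :: "'a set \<Rightarrow> ('a \<Rightarrow> real) set" where
  "funs_on E = {f. \<forall>x. x \<notin> E \<longrightarrow> f x = 0}"

definition dirac :: "'a \<Rightarrow> 'a \<Rightarrow> real" where
  "dirac e = indicator {e}"

text \<open>The linear map on \<open>funs_on E\<close>, for finite \<open>E\<close>, that sends \<open>dirac e\<close> to \<open>T e\<close>.\<close>

definition lin_ext :: "'a set \<Rightarrow> ('a \<Rightarrow> 'b \<Rightarrow> real) \<Rightarrow> ('a \<Rightarrow> real) \<Rightarrow> 'b \<Rightarrow> real" where
  "lin_ext E T f = (\<Sum>e\<in>E. fun_scale (f e) (T e))"

lemma lin_ext_apply: "lin_ext E T f x = (\<Sum>e\<in>E. f e * T e x)"
proof -
  have "(\<Sum>e\<in>E. fun_scale (f e) (T e)) x = (\<Sum>e\<in>E. fun_scale (f e) (T e) x)"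
    by (induction E rule: infinite_finite_induct) simp_all
  then show ?thesis by (simp add: lin_ext_def fun_scale_def)
qed

lemma lin_ext_dirac:
  assumes "finite E" "e \<in> E"
  shows "lin_ext E T (dirac e) = T e"
proof
  fix x
  have "lin_ext E T (dirac e) x = (\<Sum>e'\<in>E. if e' = e then T e' x else 0)"
    unfolding lin_ext_apply by (intro sum.cong) (auto simp: dirac_def indicator_def)
  then show "lin_ext E T (dirac e) x = T e x"
    using assms by simp
qed

definition ker_on :: "'v set \<Rightarrow> ('v \<Rightarrow> 'w::zero) \<Rightarrow> 'v set" where
  "ker_on V T = {f \<in> V. T f = 0}"

text \<open>Internal direct sums of subspaces, of two subspaces and of a finite family;
  \<open>+\<close> and \<open>\<Sum>\<close> on sets are elementwise (Minkowski) sums.\<close>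

definition is_direct_sum2 ::
  "('a \<Rightarrow> real) set \<Rightarrow> ('a \<Rightarrow> real) set \<Rightarrow> ('a \<Rightarrow> real) set \<Rightarrow> bool" where
  "is_direct_sum2 V X Y \<longleftrightarrow>
     fun_space.subspace X \<and> fun_space.subspace Y \<and> V = X + Y \<and> X \<inter> Y = {0}"

definition is_direct_sum ::
  "('a \<Rightarrow> real) set \<Rightarrow> 'i set \<Rightarrow> ('i \<Rightarrow> ('a \<Rightarrow> real) set) \<Rightarrow> bool" where
  "is_direct_sum V I U \<longleftrightarrow>
     finite I \<and> (\<forall>i\<in>I. fun_space.subspace (U i)) \<and> V = (\<Sum>i\<in>I. U i) \<and>
     (\<forall>u. (\<forall>i\<in>I. u i \<in> U i) \<longrightarrow> (\<Sum>i\<in>I. u i) = 0 \<longrightarrow> (\<forall>i\<in>I. u i = 0))"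

definition subsets2 :: "'a set \<Rightarrow> 'a set set" where
  "subsets2 E = {S. S \<subseteq> E \<and> card S \<ge> 2}"

definition inj_words :: "nat \<Rightarrow> nat list set" where
  "inj_words n = {\<omega>. distinct \<omega> \<and> set \<omega> \<subseteq> {1..n}}"

text \<open>The injective words with content \<open>A\<close> are \<open>permutations_of_set A\<close>. The symmetric group is
  identified with the words of content \<open>{1..n}\<close>; its group structure plays no role.\<close>

abbreviation sym_words :: "nat \<Rightarrow> nat list set" where
  "sym_words n \<equiv> permutations_of_set {1..n}"

definition marginal :: "nat \<Rightarrow> nat set \<Rightarrow> (nat list \<Rightarrow> real) \<Rightarrow> nat list \<Rightarrow> real" where
  "marginal n A = lin_ext (sym_words n) (\<lambda>\<sigma>. dirac (filter (\<lambda>x. x \<in> A) \<sigma>))"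

lemma marginal_eq_sum:
  "marginal n A f \<pi> = (\<Sum>\<sigma> | \<sigma> \<in> sym_words n \<and> filter (\<lambda>x. x \<in> A) \<sigma> = \<pi>. f \<sigma>)"
proof -
  have "marginal n A f \<pi> =
      (\<Sum>\<sigma>\<in>sym_words n. if filter (\<lambda>x. x \<in> A) \<sigma> = \<pi> then f \<sigma> else 0)"
    unfolding marginal_def lin_ext_apply
    by (intro sum.cong) (auto simp: dirac_def indicator_def)
  also have "\<dots> = (\<Sum>\<sigma> | \<sigma> \<in> sym_words n \<and> filter (\<lambda>x. x \<in> A) \<sigma> = \<pi>. f \<sigma>)"
    by (simp add: sum.inter_filter)
  finally show ?thesis .
qed

text \<open>Elements of the direct sum of the spaces of functions on the words of content \<open>A\<close>, for
  \<open>A \<in> \<A>\<close>, are families indexed by all sets that vanish outside \<open>\<A>\<close>.\<close>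

definition marginals ::
  "nat \<Rightarrow> nat set set \<Rightarrow> (nat list \<Rightarrow> real) \<Rightarrow> nat set \<Rightarrow> nat list \<Rightarrow> real" where
  "marginals n \<A> f = (\<lambda>A. if A \<in> \<A> then marginal n A f else 0)"

definition deletion :: "nat \<Rightarrow> nat \<Rightarrow> (nat list \<Rightarrow> real) \<Rightarrow> nat list \<Rightarrow> real" where
  "deletion n a = lin_ext (inj_words n) (\<lambda>\<pi>. dirac (removeAll a \<pi>))"

definition H_space :: "nat \<Rightarrow> nat set \<Rightarrow> (nat list \<Rightarrow> real) set" where
  "H_space n B = {x \<in> funs_on (permutations_of_set B). \<forall>b\<in>B. deletion n b x = 0}"

definition phi :: "nat \<Rightarrow> (nat list \<Rightarrow> real) \<Rightarrow> nat list \<Rightarrow> real" where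
  "phi n = lin_ext (inj_words n) (\<lambda>\<pi>. indicator {\<sigma> \<in> sym_words n. sublist \<pi> \<sigma>})"

definition W_space :: "nat \<Rightarrow> nat set \<Rightarrow> (nat list \<Rightarrow> real) set" where
  "W_space n B = phi n ` H_space n B"

definition V0_space :: "nat \<Rightarrow> (nat list \<Rightarrow> real) set" where
  "V0_space n = range (\<lambda>c. fun_scale c (indicator (sym_words n)))"

end

theory Submission imports Defs begin

text \<open>
  Two facts about the marginals of the spaces \<open>W_space n B\<close> carry the proof. Take \<open>x \<in> H_space n B\<close>.
  If \<open>B\<close> is not contained in \<open>A\<close>, then \<open>marginal n A\<close> kills \<open>phi n x\<close>: restricting
  \<open>u @ \<pi> @ v\<close> to \<open>A\<close> loses some letter \<open>b\<close> of \<open>\<pi>\<close>, so the result depends on \<open>\<pi>\<close> only after the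
  deletion of \<open>b\<close>, and \<open>x\<close> vanishes under that deletion (\<open>marginal_phi_H_space_eq_0\<close>).
  If \<open>A = B\<close>, then \<open>marginal n B (phi n x)\<close> is a positive multiple of \<open>x\<close>, the factor being the number
  of ways to surround a word of content \<open>B\<close> by the other letters (\<open>marginal_phi_same\<close>).
  So the marginals are triangular on the sum of the \<open>W_space n B\<close>, with invertible diagonal.

  Triangularity gives independence (\<open>synthesis_eq_0D\<close>): if a constant plus a sum of elements
  \<open>phi n (x B)\<close> has zero marginals on all the \<open>B\<close> involved, the total mass shows that the constant is
  zero, and the \<open>B\<close>-marginal shows \<open>x B = 0\<close> by induction on the size of \<open>B\<close>. It also gives
  spanning (\<open>ex_synthesis_matching_marginals\<close>): once the marginals of a residual \<open>h\<close> on all sets of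
  size at most \<open>k\<close> vanish, its marginals on sets \<open>B\<close> of size \<open>k + 1\<close> lie in \<open>H_space n B\<close>, and subtracting
  suitable multiples of their images under \<open>phi n\<close> removes them without disturbing the smaller
  ones. At size \<open>n\<close> nothing is left, so no dimension has to be counted.

  For a collection \<open>\<A>\<close>, split the decomposition of a function at the sets \<open>B\<close> contained in a member
  of \<open>\<A>\<close>: the other components lie in the kernel of \<open>marginals n \<A>\<close>, and independence says that
  the kernel meets the span of the first ones trivially. A single \<open>A\<close> is the case \<open>\<A> = {A}\<close>.
\<close>

section \<open>Linear extensions\<close>

lemma module_hom_lin_ext: "module_hom fun_scale fun_scale (lin_ext E T)"
  by unfold_locales
    (auto simp: lin_ext_apply fun_scale_def fun_eq_iff algebra_simps sum.distrib sum_distrib_left)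

lemmas lin_ext_add = module_hom.add[OF module_hom_lin_ext]
  and lin_ext_scale = module_hom.scale[OF module_hom_lin_ext]
  and lin_ext_zero = module_hom.zero[OF module_hom_lin_ext]
  and lin_ext_diff = module_hom.diff[OF module_hom_lin_ext]
  and lin_ext_sum = module_hom.sum[OF module_hom_lin_ext]

lemma lin_ext_lin_ext:
  "lin_ext F S (lin_ext E T f) = lin_ext E (\<lambda>e. lin_ext F S (T e)) f"
  unfolding lin_ext_def[of E] lin_ext_sum lin_ext_scale ..

lemma sum_fun_apply: "(\<Sum>i\<in>I. u i) x = (\<Sum>i\<in>I. u i x :: real)"
  by (induction I rule: infinite_finite_induct) auto

lemma subspace_funs_on: "fun_space.subspace (funs_on E)"
  by (auto simp: fun_space.subspace_def funs_on_def fun_scale_def)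

lemma subspace_set_plus:
  assumes "fun_space.subspace X" "fun_space.subspace Y"
  shows "fun_space.subspace (X + Y)"
proof -
  have "X + Y = {x + y |x y. x \<in> X \<and> y \<in> Y}"
    unfolding set_plus_def by blast
  then show ?thesis using fun_space.subspace_sums[OF assms] by simp
qed

lemma subspace_sum_family:
  assumes "finite I" "\<And>i. i \<in> I \<Longrightarrow> fun_space.subspace (U i)"
  shows "fun_space.subspace (\<Sum>i\<in>I. U i)"
  using assms
proof (induction I rule: finite_induct)
  case empty
  then show ?case by simp
next
  case (insert i I)
  then show ?case
    by (simp add: subspace_set_plus)
qed

lemma finite_inj_words: "finite (inj_words n)"
  using finite_subset_distinct[of "{1..n}"] by (simp add: inj_words_def conj_commute)

lemma permutations_of_set_subset_inj_words:
  "B \<subseteq> {1..n} \<Longrightarrow> permutations_of_set B \<subseteq> inj_words n"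
  by (auto simp: permutations_of_set_def inj_words_def)

section \<open>Marginals and deletions\<close>

lemma filter_sym_words:
  "A \<subseteq> {1..n} \<Longrightarrow> \<sigma> \<in> sym_words n \<Longrightarrow>
    filter (\<lambda>x. x \<in> A) \<sigma> \<in> permutations_of_set A"
  by (auto simp: permutations_of_set_def)

lemma marginal_in_funs_on:
  assumes "A \<subseteq> {1..n}"
  shows "marginal n A f \<in> funs_on (permutations_of_set A)"
  unfolding funs_on_def marginal_eq_sum
  using filter_sym_words[OF assms] by (auto intro!: sum.neutral)

text \<open>Restriction to \<open>A'\<close> factors through restriction to \<open>A\<close>.\<close>

lemma marginal_zero_subset:
  assumes "A' \<subseteq> A" "A \<subseteq> {1..n}" "marginal n A f = 0"
  shows "marginal n A' f = 0"
proof -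
  let ?P = "permutations_of_set A"
  have "lin_ext ?P (\<lambda>\<pi>. dirac (filter (\<lambda>x. x \<in> A') \<pi>)) (marginal n A f) =
    lin_ext (sym_words n)
      (\<lambda>\<sigma>. lin_ext ?P (\<lambda>\<pi>. dirac (filter (\<lambda>x. x \<in> A') \<pi>)) (dirac (filter (\<lambda>x. x \<in> A) \<sigma>))) f"
    unfolding marginal_def by (rule lin_ext_lin_ext)
  also have "\<dots> = marginal n A' f"
    unfolding marginal_def lin_ext_def[of "sym_words n"]
    using filter_sym_words[OF assms(2)] finite_subset[OF assms(2)] \<open>A' \<subseteq> A\<close>
    by (intro sum.cong arg_cong2[where f=fun_scale] refl)
      (auto simp: lin_ext_dirac intro!: arg_cong[where f=dirac] filter_cong)
  finally show ?thesis
    using assms(3) lin_ext_zero by metis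
qed

lemma deletion_marginal:
  assumes "A \<subseteq> {1..n}"
  shows "deletion n b (marginal n A f) = marginal n (A - {b}) f"
proof -
  have "deletion n b (marginal n A f) = lin_ext (sym_words n)
      (\<lambda>\<sigma>. deletion n b (dirac (filter (\<lambda>x. x \<in> A) \<sigma>))) f"
    unfolding marginal_def deletion_def by (rule lin_ext_lin_ext)
  also have "\<dots> = marginal n (A - {b}) f"
    unfolding marginal_def lin_ext_def[of "sym_words n"] deletion_def
    using filter_sym_words[OF assms] permutations_of_set_subset_inj_words[OF assms]
    by (intro sum.cong arg_cong2[where f=fun_scale] refl)
      (auto simp: lin_ext_dirac finite_inj_words subset_eq removeAll_filter_not_eq
        intro!: arg_cong[where f=dirac] filter_cong)
  finally show ?thesis .
qed

text \<open>Deleting a letter of \<open>A\<close> from \<open>marginal n A h\<close> produces a marginal on a smaller set, so a function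
  whose marginals vanish on smaller sets has its next marginals in the spaces \<open>H_space n A\<close>.\<close>

lemma marginal_in_H_space:
  assumes "A \<subseteq> {1..n}" "\<And>b. b \<in> A \<Longrightarrow> marginal n (A - {b}) h = 0"
  shows "marginal n A h \<in> H_space n A"
  using assms by (simp add: H_space_def marginal_in_funs_on deletion_marginal)

lemma marginal_full:
  assumes "f \<in> funs_on (sym_words n)"
  shows "marginal n {1..n} f = f"
proof
  fix \<pi>
  have "filter (\<lambda>x. x \<in> {1..n}) \<sigma> = \<sigma>" if "\<sigma> \<in> sym_words n" for \<sigma>
    using that by (auto simp: filter_id_conv permutations_of_set_def)
  then have "{\<sigma> \<in> sym_words n. filter (\<lambda>x. x \<in> {1..n}) \<sigma> = \<pi>} = (if \<pi> \<in> sym_words n then {\<pi>} else {})"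
    by auto
  then show "marginal n {1..n} f \<pi> = f \<pi>"
    using assms unfolding marginal_eq_sum by (auto simp: funs_on_def)
qed

lemma marginal_empty: "marginal n {} f = fun_scale (\<Sum>\<sigma>\<in>sym_words n. f \<sigma>) (dirac [])"
proof
  fix \<pi> :: "nat list"
  have "{\<sigma> \<in> sym_words n. filter (\<lambda>x. x \<in> {}) \<sigma> = \<pi>} = (if \<pi> = [] then sym_words n else {})"
    by auto
  then show "marginal n {} f \<pi> = fun_scale (\<Sum>\<sigma>\<in>sym_words n. f \<sigma>) (dirac []) \<pi>"
    unfolding marginal_eq_sum by (auto simp: fun_scale_def dirac_def)
qed

lemma filter_singleton:
  "distinct \<sigma> \<Longrightarrow> a \<in> set \<sigma> \<Longrightarrow> filter (\<lambda>x. x \<in> {a}) \<sigma> = [a]"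
  by (induction \<sigma>) (auto simp: filter_empty_conv)

text \<open>There is only one word on a set with at most one letter, so such a marginal only records the
  total mass.\<close>

lemma marginal_card_le_1:
  assumes "A \<subseteq> {1..n}" "card A \<le> 1" "(\<Sum>\<sigma>\<in>sym_words n. f \<sigma>) = 0"
  shows "marginal n A f = 0"
proof (cases "card A = 0")
  case True
  then have "A = {}" using assms finite_subset by fastforce
  then show ?thesis using assms by (simp add: marginal_empty)
next
  case False
  then have "card A = 1" using assms by simp
  then obtain a where A: "A = {a}" by (auto simp: card_1_singleton_iff)
  show ?thesis
  proof
    fix \<pi>
    have "filter (\<lambda>x. x \<in> A) \<sigma> = [a]" if "\<sigma> \<in> sym_words n" for \<sigma>
      using that assms A filter_singleton[of \<sigma> a] by (auto simp: permutations_of_set_def)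
    then have "{\<sigma> \<in> sym_words n. filter (\<lambda>x. x \<in> A) \<sigma> = \<pi>} = (if \<pi> = [a] then sym_words n else {})"
      by auto
    then show "marginal n A f \<pi> = 0 \<pi>"
      unfolding marginal_eq_sum using assms by simp
  qed
qed

section \<open>Marginals of the wavelet spaces\<close>

text \<open>The pairs of words that can stand on the two sides of a word of content \<open>B\<close> in a word of full
  content. The set depends on the content only, and this makes the factor in \<open>marginal_phi_same\<close> below
  the same for all words of content \<open>B\<close>.\<close>

definition contexts :: "nat \<Rightarrow> nat set \<Rightarrow> (nat list \<times> nat list) set" where
  "contexts n B = {(u, v). u @ v \<in> permutations_of_set ({1..n} - B)}"

text \<open>In a word without repetition, the first letter of \<open>\<pi>\<close> fixes the place where \<open>\<pi>\<close> occurs. The empty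
  word occurs everywhere, whence the assumption \<open>B \<noteq> {}\<close>.\<close>

lemma bij_betw_contexts:
  assumes "B \<noteq> {}" "B \<subseteq> {1..n}" "\<pi> \<in> permutations_of_set B"
  shows "bij_betw (\<lambda>(u, v). u @ \<pi> @ v) (contexts n B) {\<sigma> \<in> sym_words n. sublist \<pi> \<sigma>}"
proof -
  have \<pi>: "set \<pi> = B" "distinct \<pi>" using assms by (auto simp: permutations_of_set_def)
  then obtain p ps where p: "\<pi> = p # ps" using assms by (cases \<pi>) auto
  have "inj_on (\<lambda>(u, v). u @ \<pi> @ v) (contexts n B)"
  proof (rule inj_onI, clarsimp)
    fix u v u' v'
    assume "(u, v) \<in> contexts n B" "(u', v') \<in> contexts n B" and e: "u @ \<pi> @ v = u' @ \<pi> @ v'"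
    then have "p \<notin> set u" "p \<notin> set (ps @ v)"
      using p \<pi> by (auto simp: contexts_def permutations_of_set_def)
    then show "u = u' \<and> v = v'"
      using e append_Cons_eq_iff[of p u "ps @ v" u' "ps @ v'"] p by simp
  qed
  moreover have "(\<lambda>(u, v). u @ \<pi> @ v) ` contexts n B = {\<sigma> \<in> sym_words n. sublist \<pi> \<sigma>}"
  proof (intro equalityI subsetI)
    fix \<sigma> assume "\<sigma> \<in> (\<lambda>(u, v). u @ \<pi> @ v) ` contexts n B"
    then obtain u v where \<sigma>: "\<sigma> = u @ \<pi> @ v" and uv: "u @ v \<in> permutations_of_set ({1..n} - B)"
      by (auto simp: contexts_def)
    then have "set u \<union> set v = {1..n} - B"
      by (simp add: permutations_of_set_def)
    then have "set \<sigma> = {1..n}"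
      using \<sigma> \<pi> assms(2) by auto
    then show "\<sigma> \<in> {\<sigma> \<in> sym_words n. sublist \<pi> \<sigma>}"
      using \<sigma> uv \<pi> by (auto simp: permutations_of_set_def sublist_def)
  next
    fix \<sigma> assume \<sigma>: "\<sigma> \<in> {\<sigma> \<in> sym_words n. sublist \<pi> \<sigma>}"
    then obtain u v where "\<sigma> = u @ \<pi> @ v" by (auto simp: sublist_def)
    moreover from this have "(u, v) \<in> contexts n B"
      using \<sigma> \<pi> by (auto simp: contexts_def permutations_of_set_def)
    ultimately show "\<sigma> \<in> (\<lambda>(u, v). u @ \<pi> @ v) ` contexts n B" by force
  qed
  ultimately show ?thesis by (simp add: bij_betw_def)
qed

lemma card_contexts_pos:
  assumes "B \<noteq> {}" "B \<subseteq> {1..n}"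
  shows "card (contexts n B) > 0"
proof -
  obtain \<pi> where \<pi>: "\<pi> \<in> permutations_of_set B"
    using finite_subset[OF assms(2)] permutations_of_set_empty_iff[of B] by blast
  have "finite (contexts n B)"
    using bij_betw_finite[OF bij_betw_contexts[OF assms \<pi>]] by simp
  moreover obtain v where "v \<in> permutations_of_set ({1..n} - B)"
    using permutations_of_set_empty_iff[of "{1..n} - B"] by blast
  then have "([], v) \<in> contexts n B" by (simp add: contexts_def)
  ultimately show ?thesis by (auto simp: card_gt_0_iff)
qed

lemma marginal_phi:
  assumes B: "B \<noteq> {}" "B \<subseteq> {1..n}" and x: "x \<in> funs_on (permutations_of_set B)"
  shows "marginal n A (phi n x) \<tau> = (\<Sum>\<pi>\<in>permutations_of_set B.
    x \<pi> * real (card {(u, v) \<in> contexts n B. filter (\<lambda>a. a \<in> A) (u @ \<pi> @ v) = \<tau>}))"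
proof -
  let ?S = "\<lambda>\<pi>. {\<sigma> \<in> sym_words n. sublist \<pi> \<sigma>}"
  have m: "marginal n A (indicator (?S \<pi>)) \<tau> =
      real (card {(u, v) \<in> contexts n B. filter (\<lambda>a. a \<in> A) (u @ \<pi> @ v) = \<tau>})"
    if \<pi>: "\<pi> \<in> permutations_of_set B" for \<pi>
  proof -
    let ?g = "\<lambda>(u, v). u @ \<pi> @ v" and ?r = "filter (\<lambda>a. a \<in> A)"
    let ?C = "{(u, v) \<in> contexts n B. ?r (u @ \<pi> @ v) = \<tau>}"
    have inj: "inj_on ?g (contexts n B)" and im: "?g ` contexts n B = ?S \<pi>"
      using bij_betw_contexts[OF B \<pi>] by (auto simp: bij_betw_def)
    have "?g ` ?C = {\<sigma> \<in> ?g ` contexts n B. ?r \<sigma> = \<tau>}"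
      by auto
    then have "?g ` ?C = {\<sigma> \<in> ?S \<pi>. ?r \<sigma> = \<tau>}"
      unfolding im .
    moreover have "inj_on ?g ?C" by (rule inj_on_subset[OF inj]) blast
    then have "card (?g ` ?C) = card ?C" by (rule card_image)
    ultimately have "card ?C = card {\<sigma> \<in> ?S \<pi>. ?r \<sigma> = \<tau>}" by simp
    moreover have "marginal n A (indicator (?S \<pi>)) \<tau> =
      (\<Sum>\<sigma> | \<sigma> \<in> sym_words n \<and> ?r \<sigma> = \<tau>. if sublist \<pi> \<sigma> then 1 else 0)"
      unfolding marginal_eq_sum by (intro sum.cong) (auto simp: indicator_def)
    moreover have "\<dots> = real (card {\<sigma> \<in> ?S \<pi>. ?r \<sigma> = \<tau>})"
      by (subst sum.inter_filter[symmetric]) (auto intro!: arg_cong[where f=card])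
    ultimately show ?thesis by simp
  qed
  have "phi n x = (\<Sum>\<pi>\<in>permutations_of_set B. fun_scale (x \<pi>) (indicator (?S \<pi>)))"
    unfolding phi_def lin_ext_def
    using x permutations_of_set_subset_inj_words[OF B(2)]
    by (intro sum.mono_neutral_right finite_inj_words)
      (auto simp: funs_on_def fun_scale_def fun_eq_iff)
  then have "marginal n A (phi n x) =
      (\<Sum>\<pi>\<in>permutations_of_set B. fun_scale (x \<pi>) (marginal n A (indicator (?S \<pi>))))"
    by (simp add: marginal_def lin_ext_sum lin_ext_scale)
  then have "marginal n A (phi n x) \<tau> =
      (\<Sum>\<pi>\<in>permutations_of_set B. x \<pi> * marginal n A (indicator (?S \<pi>)) \<tau>)"
    by (simp add: sum_fun_apply fun_scale_def)
  then show ?thesis using m by simp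
qed

text \<open>Group the words by their image under the deletion of \<open>b\<close>: the sum of \<open>x\<close> over each group is a value
  of \<open>deletion n b x\<close>, hence zero.\<close>

lemma H_space_sum_removeAll:
  assumes B: "B \<subseteq> {1..n}" "b \<in> B" and x: "x \<in> H_space n B"
  shows "(\<Sum>\<pi>\<in>permutations_of_set B. x \<pi> * g (removeAll b \<pi>)) = 0"
proof -
  let ?P = "permutations_of_set B"
  have del: "(\<Sum>\<pi> | \<pi> \<in> ?P \<and> removeAll b \<pi> = \<rho>. x \<pi>) = 0" for \<rho>
  proof -
    have "0 = deletion n b x \<rho>" using x B by (simp add: H_space_def)
    also have "\<dots> = (\<Sum>\<pi>\<in>?P. x \<pi> * dirac (removeAll b \<pi>) \<rho>)"
      unfolding deletion_def lin_ext_apply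
      using x permutations_of_set_subset_inj_words[OF B(1)]
      by (intro sum.mono_neutral_right finite_inj_words) (auto simp: H_space_def funs_on_def)
    also have "\<dots> = (\<Sum>\<pi>\<in>?P. if removeAll b \<pi> = \<rho> then x \<pi> else 0)"
      by (intro sum.cong) (auto simp: dirac_def indicator_def)
    also have "\<dots> = (\<Sum>\<pi> | \<pi> \<in> ?P \<and> removeAll b \<pi> = \<rho>. x \<pi>)"
      by (simp add: sum.inter_filter)
    finally show ?thesis by simp
  qed
  have "(\<Sum>\<pi>\<in>?P. x \<pi> * g (removeAll b \<pi>)) =
      (\<Sum>\<rho>\<in>removeAll b ` ?P. \<Sum>\<pi> | \<pi> \<in> ?P \<and> removeAll b \<pi> = \<rho>. x \<pi> * g (removeAll b \<pi>))"
    by (rule sum.image_gen) simp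
  also have "\<dots> = (\<Sum>\<rho>\<in>removeAll b ` ?P. (\<Sum>\<pi> | \<pi> \<in> ?P \<and> removeAll b \<pi> = \<rho>. x \<pi>) * g \<rho>)"
    by (simp add: sum_distrib_right)
  finally show ?thesis by (simp add: del)
qed

text \<open>For \<open>b\<close> in \<open>B\<close> but not in \<open>A\<close>, the coefficient of \<open>x \<pi>\<close> in \<open>marginal_phi\<close> does not see the letter
  \<open>b\<close> of \<open>\<pi>\<close>, so it is a function of \<open>removeAll b \<pi>\<close>.\<close>

lemma marginal_phi_H_space_eq_0:
  assumes "B \<subseteq> {1..n}" "x \<in> H_space n B" "\<not> B \<subseteq> A"
  shows "marginal n A (phi n x) = 0"
proof
  fix \<tau>
  obtain b where b: "b \<in> B" "b \<notin> A" using assms by auto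
  define g where "g \<rho> = real (card {(u, v) \<in> contexts n B.
    filter (\<lambda>a. a \<in> A) u @ filter (\<lambda>a. a \<in> A) \<rho> @ filter (\<lambda>a. a \<in> A) v = \<tau>})" for \<rho>
  have "filter (\<lambda>a. a \<in> A) (removeAll b \<pi>) = filter (\<lambda>a. a \<in> A) \<pi>" for \<pi>
    using b by (auto simp: removeAll_filter_not_eq intro!: filter_cong)
  then have "g (removeAll b \<pi>) = g \<pi>" for \<pi> by (simp add: g_def)
  then have "(\<Sum>\<pi>\<in>permutations_of_set B. x \<pi> * g \<pi>) = 0"
    using H_space_sum_removeAll[OF assms(1) b(1) assms(2), of g] by simp
  moreover have "B \<noteq> {}" "x \<in> funs_on (permutations_of_set B)"
    using b assms by (auto simp: H_space_def)
  ultimately show "marginal n A (phi n x) \<tau> = 0 \<tau>"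
    using assms by (simp add: marginal_phi[of B] g_def)
qed

text \<open>Restricting \<open>u @ \<pi> @ v\<close> to the content \<open>B\<close> of \<open>\<pi>\<close> gives back \<open>\<pi>\<close>, whatever the context is.\<close>

lemma marginal_phi_same:
  assumes "B \<noteq> {}" "B \<subseteq> {1..n}" "x \<in> funs_on (permutations_of_set B)"
  shows "marginal n B (phi n x) = fun_scale (real (card (contexts n B))) x"
proof
  fix \<tau>
  have "{(u, v) \<in> contexts n B. filter (\<lambda>a. a \<in> B) (u @ \<pi> @ v) = \<tau>} =
      (if \<pi> = \<tau> then contexts n B else {})" if "\<pi> \<in> permutations_of_set B" for \<pi>
  proof -
    have "filter (\<lambda>a. a \<in> B) (u @ \<pi> @ v) = \<pi>" if "(u, v) \<in> contexts n B" for u v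
    proof -
      have "filter (\<lambda>a. a \<in> B) u = []" "filter (\<lambda>a. a \<in> B) v = []"
        using that by (auto simp: contexts_def permutations_of_set_def filter_empty_conv)
      moreover have "filter (\<lambda>a. a \<in> B) \<pi> = \<pi>"
        using \<open>\<pi> \<in> permutations_of_set B\<close> by (auto simp: filter_id_conv permutations_of_set_def)
      ultimately show ?thesis by simp
    qed
    then show ?thesis by auto
  qed
  then have "marginal n B (phi n x) \<tau> = (\<Sum>\<pi>\<in>permutations_of_set B.
      if \<pi> = \<tau> then x \<pi> * real (card (contexts n B)) else 0)"
    unfolding marginal_phi[OF assms] by (intro sum.cong) auto
  then show "marginal n B (phi n x) \<tau> = fun_scale (real (card (contexts n B))) x \<tau>"
    using assms(3) by (auto simp: fun_scale_def funs_on_def)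
qed

section \<open>The multiresolution decomposition\<close>

text \<open>When each \<open>x B\<close> lies in \<open>H_space n B\<close>, these are the elements of
  \<open>V0_space n + (\<Sum>B\<in>\<B>. W_space n B)\<close>, with \<open>c\<close> and \<open>x\<close> as coordinates.\<close>

definition synthesis ::
  "nat \<Rightarrow> nat set set \<Rightarrow> real \<Rightarrow> (nat set \<Rightarrow> nat list \<Rightarrow> real) \<Rightarrow> nat list \<Rightarrow> real" where
  "synthesis n \<B> c x = fun_scale c (indicator (sym_words n)) + (\<Sum>B\<in>\<B>. phi n (x B))"

lemma finite_subsets2: "finite E \<Longrightarrow> finite (subsets2 E)"
  by (simp add: subsets2_def)

lemma marginal_synthesis:
  "marginal n A (synthesis n \<B> c x) =
    fun_scale c (marginal n A (indicator (sym_words n))) + (\<Sum>B\<in>\<B>. marginal n A (phi n (x B)))"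
  unfolding synthesis_def marginal_def by (simp add: lin_ext_add lin_ext_scale lin_ext_sum)

lemma subspace_H_space: "fun_space.subspace (H_space n B)"
  using subspace_funs_on[of "permutations_of_set B"]
  unfolding H_space_def fun_space.subspace_def deletion_def
  by (auto simp: lin_ext_add lin_ext_scale lin_ext_zero)

text \<open>If \<open>x B\<close> is already known to vanish for the smaller sets of \<open>\<B>\<close>, then the \<open>B\<close>-marginal of the
  synthesis is a nonzero multiple of \<open>x B\<close>. The empty marginal, which is the total mass, starts the
  induction by isolating \<open>c\<close>.\<close>

lemma synthesis_eq_0D:
  assumes \<B>: "\<B> \<subseteq> subsets2 {1..n}"
    and x: "\<And>B. B \<in> \<B> \<Longrightarrow> x B \<in> H_space n B"
    and M0: "marginal n {} (synthesis n \<B> c x) = 0"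
    and M: "\<And>B. B \<in> \<B> \<Longrightarrow> marginal n B (synthesis n \<B> c x) = 0"
  shows "c = 0" "B \<in> \<B> \<Longrightarrow> x B = 0"
proof -
  have fin: "finite \<B>" by (rule finite_subset[OF \<B>]) (simp add: finite_subsets2)
  have sub: "B \<subseteq> {1..n}" "B \<noteq> {}" if "B \<in> \<B>" for B
    using that \<B> by (auto simp: subsets2_def)
  have "(\<Sum>B\<in>\<B>. marginal n {} (phi n (x B))) = 0"
  proof (intro sum.neutral ballI)
    fix B assume B: "B \<in> \<B>"
    show "marginal n {} (phi n (x B)) = 0"
      by (rule marginal_phi_H_space_eq_0[OF sub(1)[OF B] x[OF B]]) (use sub(2)[OF B] in simp)
  qed
  then have "marginal n {} (synthesis n \<B> c x) [] = c * fact n"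
    unfolding marginal_synthesis by (simp add: marginal_empty fun_scale_def dirac_def)
  then show c: "c = 0" by (simp add: M0)
  show "B \<in> \<B> \<Longrightarrow> x B = 0"
  proof (induction "card B" arbitrary: B rule: less_induct)
    case less
    have "marginal n B (phi n (x B')) = 0" if B': "B' \<in> \<B> - {B}" for B'
    proof (cases "B' \<subseteq> B")
      case True
      then have "card B' < card B"
        using B' finite_subset[OF sub(1)[OF less.prems]] by (intro psubset_card_mono) auto
      then have "x B' = 0" using less.hyps B' by blast
      then show ?thesis by (simp add: phi_def marginal_def lin_ext_zero)
    next
      case False
      then show ?thesis
        using B' x sub(1) by (intro marginal_phi_H_space_eq_0[of B']) blast+
    qed
    then have "(\<Sum>B'\<in>\<B>. marginal n B (phi n (x B'))) = marginal n B (phi n (x B))"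
      by (subst sum.remove[OF fin less.prems]) simp
    then have "marginal n B (phi n (x B)) = marginal n B (synthesis n \<B> c x)"
      by (simp add: marginal_synthesis c)
    also have "\<dots> = 0" by (rule M[OF less.prems])
    finally have "fun_scale (real (card (contexts n B))) (x B) = 0"
      using x[OF less.prems] sub[OF less.prems] by (simp add: marginal_phi_same H_space_def)
    then show ?case
      using card_contexts_pos[OF sub(2,1)[OF less.prems]] by (simp add: fun_space.scale_eq_0_iff)
  qed
qed

text \<open>The coordinates are found scale by scale. A correction on the sets of size \<open>k + 1\<close> does not change
  the marginals on smaller sets, nor the marginals on the other sets of that size, since none of these
  sets contains the set being corrected.\<close>

lemma ex_synthesis_matching_marginals:
  assumes "k \<ge> 1"
  shows "\<exists>c x. (\<forall>B. x B \<in> H_space n B) \<and>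
    (\<forall>A \<subseteq> {1..n}. card A \<le> k \<longrightarrow> marginal n A (f - synthesis n (subsets2 {1..n}) c x) = 0)"
  using assms
proof (induction k rule: nat_induct_at_least)
  case base
  define c where "c = (\<Sum>\<sigma>\<in>sym_words n. f \<sigma>) / fact n"
  have "synthesis n (subsets2 {1..n}) c (\<lambda>_. 0) = fun_scale c (indicator (sym_words n))"
    by (simp add: synthesis_def phi_def lin_ext_zero)
  then have "(\<Sum>\<sigma>\<in>sym_words n. (f - synthesis n (subsets2 {1..n}) c (\<lambda>_. 0)) \<sigma>) = 0"
    by (simp add: sum_subtractf fun_scale_def c_def)
  moreover have "0 \<in> H_space n B" for B
    using subspace_H_space by (rule fun_space.subspace_0)
  ultimately show ?case
    by (intro exI[of _ c] exI[of _ "\<lambda>_. 0"] conjI allI impI marginal_card_le_1)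
next
  case (Suc k)
  then obtain c x where x: "\<And>B. x B \<in> H_space n B"
    and M: "\<And>A. A \<subseteq> {1..n} \<Longrightarrow> card A \<le> k \<Longrightarrow>
      marginal n A (f - synthesis n (subsets2 {1..n}) c x) = 0"
    by blast
  define h where "h = f - synthesis n (subsets2 {1..n}) c x"
  define \<C> where "\<C> = {B. B \<subseteq> {1..n} \<and> card B = Suc k}"
  \<comment> \<open>Dividing by the number of contexts gives \<open>phi n (y B)\<close> the same \<open>B\<close>-marginal as \<open>h\<close>.\<close>
  define y where "y B = (if B \<in> \<C> then fun_scale (1 / card (contexts n B)) (marginal n B h) else 0)" for B
  have C: "\<C> \<subseteq> subsets2 {1..n}" using Suc.hyps by (auto simp: \<C>_def subsets2_def)
  have y: "y B \<in> H_space n B" for B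
  proof (cases "B \<in> \<C>")
    case True
    then have "marginal n (B - {b}) h = 0" if "b \<in> B" for b
      using M[of "B - {b}"] that by (auto simp: \<C>_def h_def intro: card_Diff_singleton)
    then have "marginal n B h \<in> H_space n B"
      using True by (intro marginal_in_H_space) (auto simp: \<C>_def)
    then show ?thesis
      using fun_space.subspace_scale[OF subspace_H_space] by (simp add: True y_def)
  next
    case False
    then show ?thesis using fun_space.subspace_0[OF subspace_H_space] by (simp add: y_def)
  qed
  have rest: "f - synthesis n (subsets2 {1..n}) c (x + y) = h - (\<Sum>B\<in>\<C>. phi n (y B))"
  proof -
    have "(\<Sum>B\<in>subsets2 {1..n}. phi n (y B)) = (\<Sum>B\<in>\<C>. phi n (y B))"
      using C by (intro sum.mono_neutral_right)
        (auto simp: finite_subsets2 y_def phi_def lin_ext_zero)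
    then show ?thesis
      by (simp add: h_def synthesis_def phi_def lin_ext_add sum.distrib algebra_simps)
  qed
  have "marginal n A (h - (\<Sum>B\<in>\<C>. phi n (y B))) = 0"
    if A: "A \<subseteq> {1..n}" "card A \<le> Suc k" for A
  proof -
    have finC: "finite \<C>" by (rule finite_subset[OF C]) (simp add: finite_subsets2)
    have *: "marginal n A (phi n (y B)) = 0" if "B \<in> \<C>" "B \<noteq> A" for B
    proof -
      have "\<not> B \<subseteq> A"
        using that A card_seteq[of A B] finite_subset[OF A(1)] by (auto simp: \<C>_def)
      then show ?thesis
        using that y by (intro marginal_phi_H_space_eq_0[of B]) (auto simp: \<C>_def)
    qed
    have eq: "marginal n A (h - (\<Sum>B\<in>\<C>. phi n (y B))) =
        marginal n A h - (\<Sum>B\<in>\<C>. marginal n A (phi n (y B)))"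
      by (simp add: marginal_def lin_ext_diff lin_ext_sum)
    show ?thesis
    proof (cases "A \<in> \<C>")
      case True
      then have ne: "A \<noteq> {}" by (auto simp: \<C>_def)
      have "(\<Sum>B\<in>\<C>. marginal n A (phi n (y B))) = marginal n A (phi n (y A))"
        using * by (subst sum.remove[OF finC True]) simp
      also have "\<dots> = marginal n A h"
        using y[of A] True card_contexts_pos[OF ne A(1)]
        by (simp add: marginal_phi_same[OF ne A(1)] H_space_def y_def)
      finally show ?thesis by (simp add: eq)
    next
      case False
      then have "card A \<le> k" using A by (auto simp: \<C>_def)
      then have "marginal n A h = 0" using M[OF A(1)] by (simp add: h_def)
      moreover have "(\<Sum>B\<in>\<C>. marginal n A (phi n (y B))) = 0"
        using * False by (intro sum.neutral) blast
      ultimately show ?thesis by (simp add: eq)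
    qed
  qed
  moreover have "(x + y) B \<in> H_space n B" for B
    using fun_space.subspace_add[OF subspace_H_space x y] by simp
  ultimately show ?case
    using rest by metis
qed

lemma synthesis_in_funs_on: "synthesis n \<B> c x \<in> funs_on (sym_words n)"
  by (auto simp: funs_on_def synthesis_def sum_fun_apply fun_scale_def phi_def lin_ext_apply)

text \<open>The marginal on the full alphabet is the identity, so a residual without marginals is zero.\<close>

lemma ex_synthesis:
  assumes "n \<ge> 1" "f \<in> funs_on (sym_words n)"
  shows "\<exists>c x. (\<forall>B. x B \<in> H_space n B) \<and> f = synthesis n (subsets2 {1..n}) c x"
proof -
  obtain c x where x: "\<forall>B. x B \<in> H_space n B"
    and "\<forall>A \<subseteq> {1..n}. card A \<le> n \<longrightarrow>
      marginal n A (f - synthesis n (subsets2 {1..n}) c x) = 0"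
    using ex_synthesis_matching_marginals[OF assms(1)] by blast
  then have "marginal n {1..n} (f - synthesis n (subsets2 {1..n}) c x) = 0" by simp
  moreover have "f - synthesis n (subsets2 {1..n}) c x \<in> funs_on (sym_words n)"
    using assms(2) synthesis_in_funs_on by (rule fun_space.subspace_diff[OF subspace_funs_on])
  ultimately have "f - synthesis n (subsets2 {1..n}) c x = 0" using marginal_full by metis
  then have "f = synthesis n (subsets2 {1..n}) c x" by (rule right_minus_eq[THEN iffD1])
  then show ?thesis using x by blast
qed

lemma subspace_W_space: "fun_space.subspace (W_space n B)"
  unfolding W_space_def phi_def
  by (rule module_hom.subspace_image[OF module_hom_lin_ext subspace_H_space])

lemma subspace_V0_space: "fun_space.subspace (V0_space n)"
proof -
  have "V0_space n = fun_space.span {indicator (sym_words n)}"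
    by (simp add: V0_space_def fun_space.span_singleton)
  then show ?thesis by simp
qed

lemma sum_W_space:
  assumes "finite \<B>"
  shows "(\<Sum>B\<in>\<B>. W_space n B) = {\<Sum>B\<in>\<B>. phi n (x B) |x. \<forall>B\<in>\<B>. x B \<in> H_space n B}"
proof -
  have "\<exists>x. (\<forall>B\<in>\<B>. x B \<in> H_space n B) \<and> (\<Sum>B\<in>\<B>. s B) = (\<Sum>B\<in>\<B>. phi n (x B))"
    if "\<forall>B\<in>\<B>. s B \<in> W_space n B" for s
  proof -
    have "\<forall>B\<in>\<B>. \<exists>y. y \<in> H_space n B \<and> s B = phi n y"
      using that by (auto simp: W_space_def)
    from bchoice[OF this] obtain x where "\<forall>B\<in>\<B>. x B \<in> H_space n B \<and> s B = phi n (x B)"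
      by blast
    then have "(\<forall>B\<in>\<B>. x B \<in> H_space n B) \<and> (\<Sum>B\<in>\<B>. s B) = (\<Sum>B\<in>\<B>. phi n (x B))"
      by simp
    then show ?thesis by blast
  qed
  moreover have "\<exists>s. (\<Sum>B\<in>\<B>. phi n (x B)) = sum s \<B> \<and> (\<forall>B\<in>\<B>. s B \<in> W_space n B)"
    if "\<forall>B\<in>\<B>. x B \<in> H_space n B" for x
    using that by (intro exI[of _ "\<lambda>B. phi n (x B)"]) (simp add: W_space_def)
  ultimately show ?thesis
    unfolding set_sum_alt[OF assms] by blast
qed

lemma V0_space_plus_sum_W_space:
  assumes "finite \<B>"
  shows "V0_space n + (\<Sum>B\<in>\<B>. W_space n B) =
    {synthesis n \<B> c x |c x. \<forall>B\<in>\<B>. x B \<in> H_space n B}"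
  proof (intro equalityI subsetI)
  fix f assume "f \<in> V0_space n + (\<Sum>B\<in>\<B>. W_space n B)"
  then obtain v w where "v \<in> V0_space n" "w \<in> (\<Sum>B\<in>\<B>. W_space n B)" and f: "f = v + w"
    by (rule set_plus_elim)
  then show "f \<in> {synthesis n \<B> c x |c x. \<forall>B\<in>\<B>. x B \<in> H_space n B}"
    unfolding sum_W_space[OF assms] V0_space_def f by (auto simp: synthesis_def)
next
  fix f assume "f \<in> {synthesis n \<B> c x |c x. \<forall>B\<in>\<B>. x B \<in> H_space n B}"
  then show "f \<in> V0_space n + (\<Sum>B\<in>\<B>. W_space n B)"
    unfolding sum_W_space[OF assms] V0_space_def synthesis_def by (blast intro: set_plus_intro)
qed

lemma marginals_eq_0_iff: "marginals n \<A> f = 0 \<longleftrightarrow> (\<forall>A\<in>\<A>. marginal n A f = 0)"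
  by (auto simp: marginals_def fun_eq_iff)

lemma subspace_ker_marginals:
  "fun_space.subspace (ker_on (funs_on (sym_words n)) (marginals n \<A>))"
  using subspace_funs_on[of "sym_words n"]
  unfolding ker_on_def marginals_eq_0_iff fun_space.subspace_def marginal_def
  by (auto simp: lin_ext_add lin_ext_scale lin_ext_zero)

lemma decomposition_marginals:
  assumes n: "n \<ge> 1" and \<A>: "\<A> \<subseteq> subsets2 {1..n}" "\<A> \<noteq> {}"
  shows "\<exists>U W. is_direct_sum W (\<Union>A\<in>\<A>. subsets2 A) (W_space n) \<and>
    is_direct_sum2 U (V0_space n) W \<and>
    is_direct_sum2 (funs_on (sym_words n)) (ker_on (funs_on (sym_words n)) (marginals n \<A>)) U"
proof -
  define \<B> where "\<B> = (\<Union>A\<in>\<A>. subsets2 A)"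
  define W where "W = (\<Sum>B\<in>\<B>. W_space n B)"
  define K where "K = ker_on (funs_on (sym_words n)) (marginals n \<A>)"
  have \<B>: "\<B> \<subseteq> subsets2 {1..n}" using \<A> by (auto simp: \<B>_def subsets2_def)
  have fin: "finite \<B>" by (rule finite_subset[OF \<B>]) (simp add: finite_subsets2)
  have U: "V0_space n + W = {synthesis n \<B> c x |c x. \<forall>B\<in>\<B>. x B \<in> H_space n B}"
    unfolding W_def by (rule V0_space_plus_sum_W_space[OF fin])
  have indep: "c = 0 \<and> (\<forall>B\<in>\<B>. x B = 0)"
    if x: "\<forall>B\<in>\<B>. x B \<in> H_space n B" and M: "\<forall>A\<in>\<A>. marginal n A (synthesis n \<B> c x) = 0" for c x
  proof -
    have M': "marginal n B (synthesis n \<B> c x) = 0" if "A \<in> \<A>" "B \<subseteq> A" for A B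
      using that M \<A> by (intro marginal_zero_subset[of B A]) (auto simp: subsets2_def)
    \<comment> \<open>The total mass is seen by any member of \<open>\<A>\<close>; this is where \<open>\<A> \<noteq> {}\<close> matters.\<close>
    have "marginal n {} (synthesis n \<B> c x) = 0" using M' \<A> by blast
    moreover have "marginal n B (synthesis n \<B> c x) = 0" if "B \<in> \<B>" for B
      using that M' by (auto simp: \<B>_def subsets2_def)
    ultimately show ?thesis using synthesis_eq_0D[OF \<B>, of x c] x by blast
  qed
  have indep0: "c = 0 \<and> (\<forall>B\<in>\<B>. x B = 0)"
    if "\<forall>B\<in>\<B>. x B \<in> H_space n B" "synthesis n \<B> c x = 0" for c x
    using that by (intro indep) (auto simp: marginal_def lin_ext_zero)
  have subW: "fun_space.subspace W"
    unfolding W_def using fin subspace_W_space by (rule subspace_sum_family)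
  have subU: "fun_space.subspace (V0_space n + W)"
    using subspace_V0_space subW by (rule subspace_set_plus)
  have subK: "fun_space.subspace K" unfolding K_def by (rule subspace_ker_marginals)
  have "is_direct_sum W \<B> (W_space n)"
    unfolding is_direct_sum_def
  proof (intro conjI ballI allI impI)
    fix u B assume u: "\<forall>B\<in>\<B>. u B \<in> W_space n B" "(\<Sum>B\<in>\<B>. u B) = 0" and B: "B \<in> \<B>"
    then have "\<forall>B\<in>\<B>. \<exists>y. y \<in> H_space n B \<and> u B = phi n y"
      by (auto simp: W_space_def)
    from bchoice[OF this] obtain x where x: "\<forall>B\<in>\<B>. x B \<in> H_space n B \<and> u B = phi n (x B)"
      by blast
    then have "synthesis n \<B> 0 x = 0" using u by (simp add: synthesis_def)
    then have "x B = 0" using indep0 x B by blast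
    then show "u B = 0" using x B by (simp add: phi_def lin_ext_zero)
  qed (use fin subspace_W_space W_def in auto)
  moreover have "is_direct_sum2 (V0_space n + W) (V0_space n) W"
    unfolding is_direct_sum2_def
  proof (intro conjI equalityI subsetI)
    fix f assume f: "f \<in> V0_space n \<inter> W"
    then obtain c where c: "f = fun_scale c (indicator (sym_words n))" by (auto simp: V0_space_def)
    have "- f \<in> W" using f subW fun_space.subspace_neg by blast
    then obtain x where x: "- f = (\<Sum>B\<in>\<B>. phi n (x B))" "\<forall>B\<in>\<B>. x B \<in> H_space n B"
      unfolding W_def sum_W_space[OF fin] by blast
    have "synthesis n \<B> c x = 0" by (simp add: synthesis_def flip: x(1)) (simp add: c)
    then have "c = 0" using indep0 x by blast
    then show "f \<in> {0}" using c by simp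
  qed (use subW subspace_V0_space in \<open>auto intro: fun_space.subspace_0\<close>)
  moreover have "is_direct_sum2 (funs_on (sym_words n)) K (V0_space n + W)"
    unfolding is_direct_sum2_def
  proof (intro conjI equalityI subsetI)
    fix f assume "f \<in> funs_on (sym_words n)"
    then obtain c x where x: "\<forall>B. x B \<in> H_space n B"
      and f: "f = synthesis n (subsets2 {1..n}) c x"
      using ex_synthesis[OF n] by blast
    \<comment> \<open>The part of \<open>f\<close> at sets contained in no member of \<open>\<A>\<close>, which \<open>\<A>\<close> cannot observe.\<close>
    define k where "k = (\<Sum>B\<in>subsets2 {1..n} - \<B>. phi n (x B))"
    have "k = synthesis n (subsets2 {1..n} - \<B>) 0 x" by (simp add: k_def synthesis_def)
    then have "k \<in> funs_on (sym_words n)" using synthesis_in_funs_on by simp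
    moreover have "marginal n A k = 0" if "A \<in> \<A>" for A
    proof -
      have "marginal n A (phi n (x B)) = 0" if "B \<in> subsets2 {1..n} - \<B>" for B
        using that \<open>A \<in> \<A>\<close> x
        by (intro marginal_phi_H_space_eq_0[of B]) (auto simp: \<B>_def subsets2_def)
      then show ?thesis by (simp add: k_def marginal_def lin_ext_sum)
    qed
    ultimately have "k \<in> K" by (simp add: K_def ker_on_def marginals_eq_0_iff)
    moreover have "f = k + synthesis n \<B> c x"
      unfolding f k_def synthesis_def
      using sum.subset_diff[OF \<B>, of "\<lambda>B. phi n (x B)"]
      by (simp add: finite_subsets2 algebra_simps del: One_nat_def)
    ultimately show "f \<in> K + (V0_space n + W)"
      unfolding U using x by blast
  next
    fix f assume "f \<in> K + (V0_space n + W)"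
    then obtain k c x where "k \<in> K" and f: "f = k + synthesis n \<B> c x"
      unfolding U by (blast elim: set_plus_elim)
    then have "k \<in> funs_on (sym_words n)" by (simp add: K_def ker_on_def)
    then show "f \<in> funs_on (sym_words n)"
      unfolding f using synthesis_in_funs_on by (rule fun_space.subspace_add[OF subspace_funs_on])
  next
    fix f assume f: "f \<in> K \<inter> (V0_space n + W)"
    then obtain c x where x: "\<forall>B\<in>\<B>. x B \<in> H_space n B" and fe: "f = synthesis n \<B> c x"
      unfolding U by auto
    have "\<forall>A\<in>\<A>. marginal n A f = 0"
      using f by (simp add: K_def ker_on_def marginals_eq_0_iff)
    then have "c = 0 \<and> (\<forall>B\<in>\<B>. x B = 0)" using indep x fe by blast
    then show "f \<in> {0}" by (simp add: fe synthesis_def phi_def lin_ext_zero)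
  qed (use subK subU in \<open>auto intro: fun_space.subspace_0\<close>)
  ultimately show ?thesis unfolding \<B>_def K_def by blast
qed

theorem corollary1:
  fixes n :: nat
  assumes "n \<ge> 1"
  shows
    "(\<forall>A \<in> subsets2 {1..n}. \<exists>U W.
        is_direct_sum W (subsets2 A) (W_space n) \<and>
        is_direct_sum2 U (V0_space n) W \<and>
        is_direct_sum2 (funs_on (sym_words n)) (ker_on (funs_on (sym_words n)) (marginal n A)) U) \<and>
     (\<forall>\<A> \<subseteq> subsets2 {1..n}. \<A> \<noteq> {} \<longrightarrow> (\<exists>U W.
        is_direct_sum W (\<Union>A\<in>\<A>. subsets2 A) (W_space n) \<and>
        is_direct_sum2 U (V0_space n) W \<and>
        is_direct_sum2 (funs_on (sym_words n)) (ker_on (funs_on (sym_words n)) (marginals n \<A>)) U))"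
proof (intro conjI ballI allI impI)
  fix A assume A: "A \<in> subsets2 {1..n}"
  have "ker_on (funs_on (sym_words n)) (marginals n {A}) =
      ker_on (funs_on (sym_words n)) (marginal n A)"
    by (simp add: ker_on_def marginals_eq_0_iff)
  then show "\<exists>U W. is_direct_sum W (subsets2 A) (W_space n) \<and>
      is_direct_sum2 U (V0_space n) W \<and>
      is_direct_sum2 (funs_on (sym_words n)) (ker_on (funs_on (sym_words n)) (marginal n A)) U"
    using decomposition_marginals[OF assms, of "{A}"] A by simp
qed (rule decomposition_marginals[OF assms])

end
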